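(* Let $F$ be Thompson's group, with the word metric $d$ of the finite generating set $\{x_0,x_1\}$, and let $\phi:F\to F$ be the shift map, i.e. the homomorphism with $\phi(x_k)=x_{k+1}$ for all $k\ge 0$. Then for every integer $n\ge 0$ the $n$-fold iterate $\phi^n:F\to F$ is a quasi-isometric embedding; that is, there are constants $K\ge 1$ and $C\ge 0$ (depending on $n$) such that $$\frac1K\, d(u,v)-C\;\le\; d(\phi^n(u),\phi^n(v))\;\le\; K\,d(u,v)+C\qquad\text{for all }u,v\in F.$$
   Context: Thompson's group $F$ is the group with infinite presentation $\langle x_k,\ k\ge 0 \mid x_i^{-1}x_jx_i=x_{j+1}\text{ if } i<j\rangle$. It is generated by $x_0,x_1$ and has the finite presentation $\langle x_0,x_1\mid [x_0x_1^{-1},x_0^{-1}x_1x_0],\,[x_0x_1^{-1},x_0^{-2}x_1x_0^2]\rangle$. For $w\in F$, $|w|$ denotes the word length with respect to $\{x_0,x_1\}$, and the word metric is $d(u,v)=|u^{-1}v|$. The shift map $\phi$ increases the index of each generator $x_k$ of the infinite presentation by $1$; this defines a homomorphism $F\to F$. *)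

theory Defs
  imports Complex_Main "HOL-Algebra.Generated_Groups"
begin

text \<open>
  A letter \<open>(a, True)\<close> stands for the generator \<open>a\<close>, and \<open>(a, False)\<close> for its formal inverse.
  A pair \<open>(r, s)\<close> in a set of relations stands for the defining relation \<open>r = s\<close>.
\<close>

type_synonym 'a word = "('a \<times> bool) list"

inductive word_eq :: "('a word \<times> 'a word) set \<Rightarrow> 'a word \<Rightarrow> 'a word \<Rightarrow> bool"
  for R :: "('a word \<times> 'a word) set"
where
  word_eq_refl: "word_eq R u u"
| word_eq_sym: "word_eq R u v \<Longrightarrow> word_eq R v u"
| word_eq_trans: "word_eq R u v \<Longrightarrow> word_eq R v w \<Longrightarrow> word_eq R u w"
| word_eq_cancel: "word_eq R (u @ [(a, b), (a, \<not> b)] @ v) (u @ v)"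
| word_eq_rel: "(r, s) \<in> R \<Longrightarrow> word_eq R (u @ r @ v) (u @ s @ v)"

definition word_class :: "('a word \<times> 'a word) set \<Rightarrow> 'a word \<Rightarrow> 'a word set" where
  "word_class R w = {v. word_eq R w v}"

definition presented_group :: "('a word \<times> 'a word) set \<Rightarrow> 'a word set monoid" where
  "presented_group R =
     \<lparr>carrier = range (word_class R),
      mult = (\<lambda>A B. \<Union>a\<in>A. \<Union>b\<in>B. word_class R (a @ b)),
      one = word_class R []\<rparr>"

lemma word_class_eq_iff: "word_class R u = word_class R v \<longleftrightarrow> word_eq R u v"
  unfolding word_class_def by (blast intro: word_eq.intros)

lemma word_eq_append_left: "word_eq R u v \<Longrightarrow> word_eq R (t @ u) (t @ v)"
proof (induction rule: word_eq.induct)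
  case (word_eq_cancel u a b v)
  show ?case using word_eq.word_eq_cancel[of R "t @ u" a b v] by simp
next
  case (word_eq_rel r s u v)
  then show ?case using word_eq.word_eq_rel[of r s R "t @ u" v] by simp
qed (blast intro: word_eq.intros)+

lemma word_eq_append_right: "word_eq R u v \<Longrightarrow> word_eq R (u @ t) (v @ t)"
proof (induction rule: word_eq.induct)
  case (word_eq_cancel u a b v)
  show ?case using word_eq.word_eq_cancel[of R u a b "v @ t"] by simp
next
  case (word_eq_rel r s u v)
  then show ?case using word_eq.word_eq_rel[of r s R u "v @ t"] by simp
qed (blast intro: word_eq.intros)+

lemma word_eq_append: "word_eq R u u' \<Longrightarrow> word_eq R v v' \<Longrightarrow> word_eq R (u @ v) (u' @ v')"
  by (blast intro: word_eq_trans word_eq_append_left word_eq_append_right)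

lemma carrier_presented_group: "carrier (presented_group R) = range (word_class R)"
  by (simp add: presented_group_def)

lemma word_class_in_carrier [simp]: "word_class R w \<in> carrier (presented_group R)"
  by (simp add: presented_group_def)

lemma one_presented_group: "\<one>\<^bsub>presented_group R\<^esub> = word_class R []"
  by (simp add: presented_group_def)

lemma mult_presented_group:
  "word_class R u \<otimes>\<^bsub>presented_group R\<^esub> word_class R v = word_class R (u @ v)"
proof -
  have "word_class R (a @ b) = word_class R (u @ v)"
    if "a \<in> word_class R u" "b \<in> word_class R v" for a b
    using that unfolding word_class_eq_iff
    by (auto simp: word_class_def intro: word_eq_append word_eq_sym)
  moreover have "u \<in> word_class R u" "v \<in> word_class R v"
    by (auto simp: word_class_def word_eq_refl)
  ultimately show ?thesis
    unfolding presented_group_def monoid.simps by blast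
qed

definition inverse_word :: "'a word \<Rightarrow> 'a word" where
  "inverse_word w = rev (map (\<lambda>(a, b). (a, \<not> b)) w)"

lemma inverse_word_left: "word_eq R (inverse_word w @ w) []"
proof (induction w)
  case Nil
  show ?case by (simp add: inverse_word_def word_eq_refl)
next
  case (Cons x w)
  obtain a b where x: "x = (a, b)" by force
  have "word_eq R (inverse_word w @ [(a, \<not> b), (a, \<not> \<not> b)] @ w) (inverse_word w @ w)"
    by (rule word_eq_cancel)
  then show ?case
    using Cons by (auto simp: inverse_word_def x intro: word_eq_trans)
qed

lemma group_presented_group: "group (presented_group R)"
proof (rule groupI)
  fix x assume "x \<in> carrier (presented_group R)"
  then obtain w where "x = word_class R w" by (auto simp: carrier_presented_group)
  then show "\<exists>y\<in>carrier (presented_group R). y \<otimes>\<^bsub>presented_group R\<^esub> x = \<one>\<^bsub>presented_group R\<^esub>"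
    by (intro bexI[of _ "word_class R (inverse_word w)"])
       (auto simp: mult_presented_group one_presented_group word_class_eq_iff inverse_word_left)
qed (auto simp: carrier_presented_group mult_presented_group one_presented_group)

lemma inv_letter_presented_group:
  "inv\<^bsub>presented_group R\<^esub> (word_class R [(a, True)]) = word_class R [(a, False)]"
proof -
  interpret group "presented_group R" by (rule group_presented_group)
  have "word_class R [(a, False)] \<otimes>\<^bsub>presented_group R\<^esub> word_class R [(a, True)] = \<one>\<^bsub>presented_group R\<^esub>"
    using word_eq_cancel[of R "[]" a False "[]"]
    by (simp add: mult_presented_group one_presented_group word_class_eq_iff)
  then show ?thesis by (intro inv_equality) auto
qed

text \<open>
  These notions are intended for a generating set \<open>S\<close> of \<open>G\<close>; otherwise \<open>LEAST\<close> may range over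
  the empty set.
\<close>

definition word_length :: "('a, 'b) monoid_scheme \<Rightarrow> 'a set \<Rightarrow> 'a \<Rightarrow> nat" where
  "word_length G S g =
     (LEAST n. \<exists>ws. set ws \<subseteq> S \<union> m_inv G ` S \<and> length ws = n \<and>
                    foldr (mult G) ws (one G) = g)"

definition word_metric :: "('a, 'b) monoid_scheme \<Rightarrow> 'a set \<Rightarrow> 'a \<Rightarrow> 'a \<Rightarrow> real" where
  "word_metric G S u v = real (word_length G S (inv\<^bsub>G\<^esub> u \<otimes>\<^bsub>G\<^esub> v))"

definition quasi_isometric_embedding ::
  "'a set \<Rightarrow> ('a \<Rightarrow> 'a \<Rightarrow> real) \<Rightarrow> 'b set \<Rightarrow> ('b \<Rightarrow> 'b \<Rightarrow> real) \<Rightarrow> ('a \<Rightarrow> 'b) \<Rightarrow> bool"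
where
  "quasi_isometric_embedding X dX Y dY f \<longleftrightarrow>
     f \<in> X \<rightarrow> Y \<and>
     (\<exists>K C. K \<ge> 1 \<and> C \<ge> 0 \<and>
        (\<forall>u\<in>X. \<forall>v\<in>X. 1 / K * dX u v - C \<le> dY (f u) (f v) \<and>
                      dY (f u) (f v) \<le> K * dX u v + C))"

definition thompson_relations :: "(nat word \<times> nat word) set" where
  "thompson_relations =
     {([(i, False), (j, True), (i, True)], [(j + 1, True)]) | i j. i < j}"

definition thompson_F :: "nat word set monoid" where
  "thompson_F = presented_group thompson_relations"

definition thompson_x :: "nat \<Rightarrow> nat word set" where
  "thompson_x k = word_class thompson_relations [(k, True)]"

definition shift :: "nat word set \<Rightarrow> nat word set" where
  "shift A = (\<Union>w\<in>A. word_class thompson_relations (map (\<lambda>(k, b). (k + 1, b)) w))"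

lemma group_thompson_F: "group thompson_F"
  by (simp add: thompson_F_def group_presented_group)

lemma thompson_x_in_carrier [simp]: "thompson_x k \<in> carrier thompson_F"
  by (simp add: thompson_F_def thompson_x_def)

lemma thompson_F_relation:
  assumes "i < j"
  shows "inv\<^bsub>thompson_F\<^esub> (thompson_x i) \<otimes>\<^bsub>thompson_F\<^esub> thompson_x j \<otimes>\<^bsub>thompson_F\<^esub> thompson_x i
         = thompson_x (j + 1)"
proof -
  have "([(i, False), (j, True), (i, True)], [(j + 1, True)]) \<in> thompson_relations"
    using assms by (auto simp: thompson_relations_def)
  from word_eq_rel[OF this, of "[]" "[]"] show ?thesis
    by (simp add: thompson_F_def thompson_x_def inv_letter_presented_group mult_presented_group
        word_class_eq_iff)
qed

lemma word_eq_shift: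
  "word_eq thompson_relations u v \<Longrightarrow>
   word_eq thompson_relations (map (\<lambda>(k, b). (k + 1, b)) u) (map (\<lambda>(k, b). (k + 1, b)) v)"
proof (induction rule: word_eq.induct)
  case (word_eq_cancel u a b v)
  show ?case
    using word_eq.word_eq_cancel[of thompson_relations "map (\<lambda>(k, b). (k + 1, b)) u" "a + 1" b] by simp
next
  case (word_eq_rel r s u v)
  then have "(map (\<lambda>(k, b). (k + 1, b)) r, map (\<lambda>(k, b). (k + 1, b)) s) \<in> thompson_relations"
    by (auto simp: thompson_relations_def)
  then show ?case
    by (simp only: map_append) (rule word_eq.word_eq_rel)
qed (blast intro: word_eq.intros)+

lemma shift_word_class:
  "shift (word_class thompson_relations w)
   = word_class thompson_relations (map (\<lambda>(k, b). (k + 1, b)) w)"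
proof -
  have "word_class thompson_relations (map (\<lambda>(k, b). (k + 1, b)) v)
        = word_class thompson_relations (map (\<lambda>(k, b). (k + 1, b)) w)"
    if "v \<in> word_class thompson_relations w" for v
    using that word_eq_shift unfolding word_class_eq_iff
    by (auto simp: word_class_def intro: word_eq_sym)
  moreover have "w \<in> word_class thompson_relations w"
    by (auto simp: word_class_def word_eq_refl)
  ultimately show ?thesis unfolding shift_def by blast
qed

lemma shift_hom: "shift \<in> hom thompson_F thompson_F"
  by (auto simp: hom_def thompson_F_def carrier_presented_group shift_word_class mult_presented_group)

lemma shift_thompson_x: "shift (thompson_x k) = thompson_x (k + 1)"
  by (simp add: thompson_x_def shift_word_class)

lemma generate_thompson_F: "generate thompson_F {thompson_x 0, thompson_x 1} = carrier thompson_F"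
proof -
  interpret group thompson_F by (rule group_thompson_F)
  let ?H = "generate thompson_F {thompson_x 0, thompson_x 1}"
  interpret H: subgroup ?H thompson_F by (rule generate_is_subgroup) simp
  have x0: "thompson_x 0 \<in> ?H" and x1: "thompson_x (0 + 1) \<in> ?H"
    by (auto intro: generate.incl)
  have x_Suc: "thompson_x (Suc k) \<in> ?H" for k
  proof (induction k)
    case 0
    show ?case using x1 by simp
  next
    case (Suc k)
    have "inv\<^bsub>thompson_F\<^esub> (thompson_x 0) \<otimes>\<^bsub>thompson_F\<^esub> thompson_x (Suc k) \<otimes>\<^bsub>thompson_F\<^esub> thompson_x 0
          = thompson_x (Suc (Suc k))"
      using thompson_F_relation[of 0 "Suc k"] by simp
    then show ?case using Suc x0 H.m_closed H.m_inv_closed by metis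
  qed
  have x: "thompson_x k \<in> ?H" for k using x0 x_Suc by (cases k) auto
  have "word_class thompson_relations w \<in> ?H" for w
  proof (induction w)
    case Nil
    show ?case using H.one_closed by (simp add: thompson_F_def one_presented_group)
  next
    case (Cons y w)
    obtain k b where y: "y = (k, b)" by force
    have "word_class thompson_relations [y] \<in> ?H"
      using x[of k] H.m_inv_closed[OF x[of k]]
      by (cases b) (simp_all add: y thompson_x_def thompson_F_def inv_letter_presented_group)
    from H.m_closed[OF this Cons] show ?case
      by (simp add: thompson_F_def mult_presented_group)
  qed
  then have "carrier thompson_F \<subseteq> ?H"
    by (auto simp: thompson_F_def carrier_presented_group)
  then show ?thesis using H.subset by blast
qed

end

theory Submission
  imports Defs
begin

text \<open>
  Every element of \<open>F\<close> is a fraction \<open>p q\<^sup>-\<^sup>1\<close> of positive words, and the size of a positive word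
  \<open>x\<^sub>i\<^sub>1 \<dots> x\<^sub>i\<^sub>k\<close>, the maximum of \<open>i\<^sub>t + (k - t) + 1\<close>, is invariant under the relations. An element of word
  length \<open>l\<close> is a fraction of positive words of size at most \<open>2l\<close>, and a positive word of size \<open>N\<close>
  has word length at most \<open>3N\<close>. If \<open>\<phi>\<^sup>m(w) = p q\<^sup>-\<^sup>1\<close> with \<open>m \<ge> 1\<close>, then \<open>p\<close> and \<open>q\<close> begin with the same
  power of \<open>x\<^sub>0\<close>, as the piecewise linear action on the line shows near \<open>0\<close>; conjugating by it and undoing one shift reduces \<open>m\<close> plus the length of \<open>p\<close>
  without increasing the sizes. Hence \<open>w\<close> is a fraction of the same size, and \<open>|w| \<le> 12 |\<phi>\<^sup>n(w)|\<close>.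
  The upper bound is \<open>|\<phi>\<^sup>n(w)| \<le> 3\<^sup>n |w|\<close>, since \<open>x\<^sub>2 = x\<^sub>0\<^sup>-\<^sup>1 x\<^sub>1 x\<^sub>0\<close>.
\<close>

section \<open>Inverses and cancellation in presented groups\<close>

lemma inverse_word_inverse_word: "inverse_word (inverse_word w) = w"
  by (induction w) (auto simp: inverse_word_def)

lemma inverse_word_right: "word_eq R (w @ inverse_word w) []"
  using inverse_word_left[of R "inverse_word w"] by (simp add: inverse_word_inverse_word)

lemma word_eq_append_left_cancel:
  assumes "word_eq R (t @ u) (t @ v)"
  shows "word_eq R u v"
proof -
  have *: "word_eq R ((inverse_word t @ t) @ w) ([] @ w)" for w
    by (intro word_eq_append_right inverse_word_left)
  show ?thesis
    using *[of u] *[of v] word_eq_append_left[OF assms, of "inverse_word t"]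
    by (simp, blast intro: word_eq_sym word_eq_trans)
qed

lemma word_eq_append_right_cancel:
  assumes "word_eq R (u @ t) (v @ t)"
  shows "word_eq R u v"
proof -
  have *: "word_eq R (w @ (t @ inverse_word t)) (w @ [])" for w
    by (intro word_eq_append_left inverse_word_right)
  show ?thesis
    using *[of u] *[of v] word_eq_append_right[OF assms, of "inverse_word t"]
    by (simp, blast intro: word_eq_sym word_eq_trans)
qed

lemma inv_presented_group:
  "inv\<^bsub>presented_group R\<^esub> (word_class R w) = word_class R (inverse_word w)"
proof -
  interpret group "presented_group R" by (rule group_presented_group)
  show ?thesis
    by (rule inv_equality)
       (simp_all add: mult_presented_group one_presented_group word_class_eq_iff inverse_word_left)
qed

declare word_eq_refl [simp] word_eq_trans [trans]

section \<open>The shift on words and conjugation by \<open>x_0\<close>\<close>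

abbreviation thompson_eq :: "nat word \<Rightarrow> nat word \<Rightarrow> bool" (infix "\<approx>" 50) where
  "u \<approx> v \<equiv> word_eq thompson_relations u v"

definition shift_word :: "nat word \<Rightarrow> nat word" where
  "shift_word = map (\<lambda>(k, b). (k + 1, b))"

lemma shift_word_simps [simp]:
  "shift_word [] = []"
  "shift_word ((k, b) # w) = (Suc k, b) # shift_word w"
  "shift_word (u @ v) = shift_word u @ shift_word v"
  "shift_word (replicate n (k, b)) = replicate n (Suc k, b)"
  by (simp_all add: shift_word_def)

lemma shift_word_cong: "u \<approx> v \<Longrightarrow> shift_word u \<approx> shift_word v"
  unfolding shift_word_def by (rule word_eq_shift)

lemma funpow_shift_word_append:
  "(shift_word ^^ n) (u @ v) = (shift_word ^^ n) u @ (shift_word ^^ n) v"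
  by (induction n) auto

lemma inverse_shift_word: "inverse_word (shift_word w) = shift_word (inverse_word w)"
  by (induction w) (auto simp: inverse_word_def)

lemma inverse_funpow_shift_word:
  "inverse_word ((shift_word ^^ n) w) = (shift_word ^^ n) (inverse_word w)"
  by (induction n) (auto simp: inverse_shift_word)

lemma thompson_comm:
  assumes "i < j"
  shows "[(j, True), (i, True)] \<approx> [(i, True), (Suc j, True)]"
proof -
  have rel: "[(i, False), (j, True), (i, True)] \<approx> [(Suc j, True)]"
    using word_eq_rel[of "[(i, False), (j, True), (i, True)]" "[(j + 1, True)]" thompson_relations "[]" "[]"]
      assms by (auto simp: thompson_relations_def)
  have "[(j, True), (i, True)] \<approx> [(i, True), (i, False), (j, True), (i, True)]"
    using word_eq_cancel[of thompson_relations "[]" i True "[(j, True), (i, True)]"]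
    by (simp add: word_eq_sym)
  also have "\<dots> \<approx> [(i, True), (Suc j, True)]"
    using word_eq_append_left[OF rel, of "[(i, True)]"] by simp
  finally show ?thesis .
qed

lemma shift_letter_x0: "[(Suc k, b), (0, True)] \<approx> [(0, True), (Suc (Suc k), b)]"
proof (cases b)
  case True
  then show ?thesis using thompson_comm[of 0 "Suc k"] by simp
next
  case False
  \<comment> \<open>Appending the trivial product \<open>x_(k+2) x_(k+2)^-1\<close> makes the
    positive relation applicable from right to left.\<close>
  have "[(Suc k, False), (0, True)] \<approx> [(Suc k, False), (0, True), (Suc (Suc k), True), (Suc (Suc k), False)]"
    using word_eq_cancel[of thompson_relations "[(Suc k, False), (0, True)]" "Suc (Suc k)" True "[]"]
    by (simp add: word_eq_sym)
  also have "\<dots> \<approx> [(Suc k, False), (Suc k, True), (0, True), (Suc (Suc k), False)]"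
    using word_eq_append_left[OF word_eq_append_right[OF word_eq_sym[OF thompson_comm[of 0 "Suc k"]]],
        of "[(Suc k, False)]" "[(Suc (Suc k), False)]"] by simp
  also have "\<dots> \<approx> [(0, True), (Suc (Suc k), False)]"
    using word_eq_cancel[of thompson_relations "[]" "Suc k" False] by simp
  finally show ?thesis using False by simp
qed

text \<open>Pulling \<open>x_0\<close> to the front raises every index that is at least 1, so
  conjugation by \<open>x_0\<close> acts on the image of the shift as the shift itself. Shifts are
  added and undone through this fact.\<close>

lemma shift_word_x0: "shift_word w @ [(0, True)] \<approx> [(0, True)] @ shift_word (shift_word w)"
proof (induction w)
  case (Cons l w)
  obtain k b where l: "l = (k, b)" by force
  have "shift_word (l # w) @ [(0, True)] \<approx> [(Suc k, b)] @ [(0, True)] @ shift_word (shift_word w)"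
    using word_eq_append_left[OF Cons, of "[(Suc k, b)]"] by (simp add: l)
  also have "\<dots> \<approx> [(0, True)] @ shift_word (shift_word (l # w))"
    using word_eq_append_right[OF shift_letter_x0[of k b]] by (simp add: l)
  finally show ?case .
qed simp

lemma shift_word_x0_power:
  "shift_word w @ replicate a (0, True) \<approx> replicate a (0, True) @ shift_word ((shift_word ^^ a) w)"
proof (induction a arbitrary: w)
  case (Suc a)
  have "shift_word w @ replicate (Suc a) (0, True) \<approx> [(0, True)] @ shift_word (shift_word w) @ replicate a (0, True)"
    using word_eq_append_right[OF shift_word_x0[of w], of "replicate a (0, True)"] by simp
  also have "\<dots> \<approx> replicate (Suc a) (0, True) @ shift_word ((shift_word ^^ Suc a) w)"
    using word_eq_append_left[OF Suc[of "shift_word w"], of "[(0, True)]"]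
    by (simp add: funpow_swap1)
  finally show ?case .
qed simp

section \<open>Positive words\<close>

definition pos :: "nat list \<Rightarrow> nat word" where
  "pos = map (\<lambda>i. (i, True))"

lemma pos_simps [simp]:
  "pos [] = []" "pos (i # p) = (i, True) # pos p" "pos (p @ q) = pos p @ pos q"
  "shift_word (pos p) = pos (map Suc p)"
  by (simp_all add: pos_def shift_word_def)

text \<open>In terms of binary forests, \<open>fits N p\<close> says that the forest of \<open>p\<close> is trivial beyond its first
  \<open>N + 1\<close> leaves.\<close>

fun fits :: "nat \<Rightarrow> nat list \<Rightarrow> bool" where
  "fits N [] \<longleftrightarrow> True"
| "fits N (i # p) \<longleftrightarrow> i + length p + 1 \<le> N \<and> fits N p"

lemma fits_length: "fits N p \<Longrightarrow> length p \<le> N"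
  by (cases p) auto

lemma fits_mono: "fits N p \<Longrightarrow> N \<le> M \<Longrightarrow> fits M p"
  by (induction p) auto

lemma fits_snoc: "fits N p \<Longrightarrow> N + 1 \<le> M \<Longrightarrow> i + 1 \<le> M \<Longrightarrow> fits M (p @ [i])"
  by (induction p) auto

lemma fits_map_Suc: "fits N (map Suc p) \<Longrightarrow> fits (N - 1) p"
  by (induction p) auto

text \<open>Moves \<open>x_i\<close> rightwards through \<open>q\<close>: passing a smaller letter
  raises the index of \<open>x_i\<close>, a larger letter reappears in \<open>s\<close> raised by 1,
  and an equal letter absorbs \<open>x_i\<close>. So at most one letter \<open>r\<close> is left
  over, and raising letters by 1 costs at most 1 in size.\<close>

lemma right_common_multiple:
  assumes "fits N q"
  shows "\<exists>r s. pos (i # s) \<approx> pos (q @ r) \<and> length s \<le> length q \<and> fits (N + 1) s \<and>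
           (r = [] \<or> (\<exists>j \<le> i + length q. r = [j]))"
  using assms
proof (induction q arbitrary: i)
  case Nil
  show ?case by (rule exI[of _ "[i]"], rule exI[of _ "[]"]) simp
next
  case (Cons j q)
  consider "i = j" | "j < i" | "i < j" by linarith
  then show ?case
  proof cases
    case 1
    then show ?thesis
      using Cons.prems by (intro exI[of _ "[]"] exI[of _ q]) (auto intro: fits_mono)
  next
    case 2
    obtain r s where *: "pos (Suc i # s) \<approx> pos (q @ r)" "length s \<le> length q" "fits (N + 1) s"
      "r = [] \<or> (\<exists>k \<le> Suc i + length q. r = [k])"
      using Cons.IH[of "Suc i"] Cons.prems by auto
    have "pos (i # j # s) \<approx> pos (j # Suc i # s)"
      using word_eq_append_right[OF thompson_comm[OF 2], of "pos s"] by simp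
    also have "\<dots> \<approx> pos ((j # q) @ r)"
      using word_eq_append_left[OF *(1), of "[(j, True)]"] by simp
    finally show ?thesis
      using * Cons.prems by (intro exI[of _ r] exI[of _ "j # s"]) auto
  next
    case 3
    obtain r s where *: "pos (i # s) \<approx> pos (q @ r)" "length s \<le> length q" "fits (N + 1) s"
      "r = [] \<or> (\<exists>k \<le> i + length q. r = [k])"
      using Cons.IH[of i] Cons.prems by auto
    have "pos (i # Suc j # s) \<approx> pos (j # i # s)"
      using word_eq_append_right[OF word_eq_sym[OF thompson_comm[OF 3]], of "pos s"] by simp
    also have "\<dots> \<approx> pos ((j # q) @ r)"
      using word_eq_append_left[OF *(1), of "[(j, True)]"] by simp
    finally show ?thesis
      using * Cons.prems by (intro exI[of _ r] exI[of _ "Suc j # s"]) auto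
  qed
qed

text \<open>Appending an inverse letter only extends the denominator; appending a positive letter
  \<open>x_i\<close> needs a common right multiple of \<open>x_i\<close> and the old denominator.
  Either way the size grows by at most \<open>i + 1\<close>.\<close>

lemma fraction_exists:
  "\<exists>p q. w @ pos q \<approx> pos p \<and> fits (\<Sum>(i, b)\<leftarrow>w. i + 1) p \<and> fits (\<Sum>(i, b)\<leftarrow>w. i + 1) q"
proof (induction w rule: rev_induct)
  case Nil
  show ?case by (rule exI[of _ "[]"], rule exI[of _ "[]"]) simp
next
  case (snoc l w)
  obtain i b where l: "l = (i, b)" by force
  let ?N = "\<Sum>(i, b)\<leftarrow>w. i + 1"
  obtain p q where pq: "w @ pos q \<approx> pos p" "fits ?N p" "fits ?N q"
    using snoc by blast
  have N: "(\<Sum>(i, b)\<leftarrow>w @ [l]. i + 1) = ?N + i + 1" by (simp add: l)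
  have len: "length q \<le> ?N" using pq(3) by (rule fits_length)
  show ?case
  proof (cases b)
    case True
    obtain r s where rs: "pos (i # s) \<approx> pos (q @ r)" "fits (?N + 1) s"
      "r = [] \<or> (\<exists>k \<le> i + length q. r = [k])"
      using right_common_multiple[OF pq(3), of i] by blast
    have "(w @ [l]) @ pos s \<approx> w @ pos q @ pos r"
      using word_eq_append_left[OF rs(1), of w] by (simp add: l True)
    also have "\<dots> \<approx> pos (p @ r)"
      using word_eq_append_right[OF pq(1), of "pos r"] by simp
    finally have "(w @ [l]) @ pos s \<approx> pos (p @ r)" .
    moreover have "fits (?N + i + 1) s" using rs(2) by (rule fits_mono) simp
    \<comment> \<open>The letter in \<open>r\<close> has index at most \<open>i + length q\<close>,
      hence at most \<open>i + ?N\<close>.\<close>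
    moreover have "fits (?N + i + 1) (p @ r)"
      using rs(3) len pq(2) by (auto intro: fits_snoc fits_mono)
    ultimately show ?thesis unfolding N by blast
  next
    case False
    have "(w @ [l]) @ pos (i # q) \<approx> w @ pos q"
      using word_eq_cancel[of thompson_relations w i False "pos q"] by (simp add: l False)
    also note pq(1)
    finally have "(w @ [l]) @ pos (i # q) \<approx> pos p" .
    moreover have "fits (?N + i + 1) p" using pq(2) by (rule fits_mono) simp
    moreover have "fits (?N + i + 1) (i # q)" using pq(3) len by (auto intro: fits_mono)
    ultimately show ?thesis unfolding N by blast
  qed
qed

text \<open>Collects all letters \<open>x_0\<close> at the front. A letter passed by
  \<open>x_0^a\<close> has its index raised by \<open>a\<close> and loses \<open>a\<close> of the
  letters to its right, so the sum that \<open>fits\<close> bounds does not change. Undoing the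
  shift of the remainder gains 1.\<close>

lemma pos_split_x0:
  assumes "fits N p"
  shows "\<exists>a p'. pos p \<approx> replicate a (0, True) @ shift_word (pos p') \<and> a + length p' = length p \<and>
           fits (N - 1) p'"
proof -
  \<comment> \<open>The induction bounds the shifted remainder; \<open>N - 1\<close> is read off
    only at the end.\<close>
  have "\<exists>a p'. pos p \<approx> replicate a (0, True) @ shift_word (pos p') \<and> a + length p' = length p \<and>
           fits N (map Suc p')"
    using assms
  proof (induction p)
    case Nil
    show ?case by (rule exI[of _ 0], rule exI[of _ "[]"]) simp
  next
    case (Cons j p)
    then obtain a p' where *: "pos p \<approx> replicate a (0, True) @ shift_word (pos p')"
      "a + length p' = length p" "fits N (map Suc p')"
      by auto
    have 1: "pos (j # p) \<approx> [(j, True)] @ replicate a (0, True) @ shift_word (pos p')"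
      using word_eq_append_left[OF *(1), of "[(j, True)]"] by simp
    show ?case
    proof (cases j)
      case 0
      then show ?thesis
        using 1 * by (intro exI[of _ "Suc a"] exI[of _ p']) auto
    next
      case (Suc k)
      have k: "(shift_word ^^ a) [(k, True)] = [(k + a, True)]"
        by (induction a) auto
      have "pos (j # p) \<approx> replicate a (0, True) @ shift_word (pos ((k + a) # p'))"
        using word_eq_trans[OF 1]
          word_eq_append_right[OF shift_word_x0_power[of "[(k, True)]" a], of "shift_word (pos p')"]
        by (simp add: Suc k)
      then show ?thesis
        using * Cons.prems Suc by (intro exI[of _ a] exI[of _ "(k + a) # p'"]) auto
    qed
  qed
  then show ?thesis by (blast dest: fits_map_Suc)
qed

section \<open>The action on the real line\<close>

text \<open>The standard piecewise linear action: \<open>x_k\<close> is the identity up to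
  \<open>k\<close>, has slope 1/2 on \<open>[k, k + 2]\<close>, and is translation by -1
  beyond.\<close>

fun letter_act :: "nat \<times> bool \<Rightarrow> real \<Rightarrow> real" where
  "letter_act (k, True) t = t - min (max ((t - real k) / 2) 0) 1"
| "letter_act (k, False) t = t + min (max (t - real k) 0) 1"

lemma letter_act_inverse: "letter_act (k, b) (letter_act (k, \<not> b) t) = t"
  by (cases b) (auto simp: min_def max_def field_simps)

text \<open>From \<open>j + 1\<close> on, \<open>x_i\<close> is translation by -1, because
  \<open>i + 2 \<le> j + 1\<close>; it carries this ray onto the ray from \<open>j\<close>, outside
  which \<open>x_j\<close> is the identity.\<close>

lemma letter_act_relation:
  assumes "i < j"
  shows "letter_act (i, False) (letter_act (j, True) (letter_act (i, True) t)) = letter_act (Suc j, True) t"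
proof -
  have "real i + 1 \<le> real j" using assms by linarith
  then show ?thesis by (simp add: min_def max_def) (auto simp: field_simps)
qed

lemma act_cong: "u \<approx> v \<Longrightarrow> foldr letter_act u t = foldr letter_act v t"
proof (induction arbitrary: t rule: word_eq.induct)
  case (word_eq_cancel u a b v)
  show ?case using letter_act_inverse[of a b] by simp
next
  case (word_eq_rel r s u v)
  then show ?case by (auto simp: thompson_relations_def letter_act_relation simp del: letter_act.simps)
qed auto

lemma act_fixes:
  assumes "\<forall>(k, b)\<in>set w. m \<le> k" "t \<le> real m"
  shows "foldr letter_act w t = t"
  using assms(1)
proof (induction w)
  case (Cons l w)
  obtain k b where l: "l = (k, b)" by force
  then have "t \<le> real k" using Cons.prems assms(2) by auto
  then show ?case using Cons by (cases b) (auto simp: l)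
qed simp

lemma act_power: "foldr letter_act (replicate a (k, True)) (real k + 1) = real k + 1 / 2 ^ a"
proof (induction a)
  case (Suc a)
  have "0 < 1 / (2 :: real) ^ a" "1 / 2 ^ a \<le> (1 :: real)" by simp_all
  with Suc show ?case by (simp del: zero_less_divide_1_iff divide_le_eq_1_pos)
qed simp

text \<open>Evaluate both sides at \<open>k + 1\<close>. Letters of index above \<open>k\<close> fix
  all points up to \<open>k + 1\<close>, and each \<open>x_k\<close> halves the distance to
  \<open>k\<close>, so the exponent can be read off from the image. The factor \<open>u\<close>
  leaves room for a shifted word in front.\<close>

lemma power_prefix_unique:
  assumes "u @ replicate a (k, True) @ v \<approx> replicate b (k, True) @ v'"
    and "\<forall>l\<in>set u \<union> set v \<union> set v'. k < fst l"
  shows "a = b"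
proof -
  have fix1: "foldr letter_act w t = t" if "\<forall>l\<in>set w. k < fst l" "t \<le> real k + 1" for w t
    using act_fixes[of w "Suc k" t] that by fastforce
  have le: "real k + 1 / 2 ^ a \<le> real k + 1" by simp
  have "real k + 1 / 2 ^ a = real k + 1 / 2 ^ b"
    using act_cong[OF assms(1), of "real k + 1"] assms(2) le by (simp add: fix1 act_power del: foldr_replicate)
  then show ?thesis by simp
qed

section \<open>Injectivity of the shift and descent of fractions\<close>

lemma fst_shift_word_pos: "l \<in> set (shift_word w) \<Longrightarrow> 0 < fst l"
  by (auto simp: shift_word_def)

lemma fst_shift_word_shift_word: "l \<in> set (shift_word (shift_word w)) \<Longrightarrow> Suc 0 < fst l"
  by (auto simp: shift_word_def)

text \<open>The outer shift is conjugation by \<open>x_0\<close> on the image of the inner one,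
  hence can be undone there.\<close>

lemma shift_word_shift_word_cancel:
  assumes "shift_word (shift_word u) \<approx> shift_word (shift_word v)"
  shows "shift_word u \<approx> shift_word v"
proof -
  have "shift_word u @ [(0, True)] \<approx> [(0, True)] @ shift_word (shift_word u)" by (rule shift_word_x0)
  also have "\<dots> \<approx> [(0, True)] @ shift_word (shift_word v)" using assms by (rule word_eq_append_left)
  also have "\<dots> \<approx> shift_word v @ [(0, True)]" by (rule word_eq_sym[OF shift_word_x0])
  finally show ?thesis by (rule word_eq_append_right_cancel)
qed

text \<open>With \<open>w\<close> written as a fraction and the powers of \<open>x_0\<close> split
  off, the shift of \<open>w\<close> vanishes and leaves an equation between the shifted numerator
  and denominator. It forces numerator and denominator to be equal already before the shift.\<close>

lemma shift_word_trivial: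
  assumes "shift_word w \<approx> []"
  shows "w \<approx> []"
proof -
  obtain p q N where pq: "w @ pos q \<approx> pos p" "fits N p" "fits N q"
    using fraction_exists by blast
  obtain a p' where p': "pos p \<approx> replicate a (0, True) @ shift_word (pos p')"
    using pos_split_x0[OF pq(2)] by blast
  obtain b q' where q': "pos q \<approx> replicate b (0, True) @ shift_word (pos q')"
    using pos_split_x0[OF pq(3)] by blast
  have "w @ replicate b (0, True) @ shift_word (pos q') \<approx> w @ pos q"
    by (intro word_eq_append_left word_eq_sym[OF q'])
  also note pq(1)
  also note p'
  finally have w: "w @ replicate b (0, True) @ shift_word (pos q') \<approx> replicate a (0, True) @ shift_word (pos p')" .
  have "replicate b (Suc 0, True) @ shift_word (shift_word (pos q'))
      \<approx> shift_word (w @ replicate b (0, True) @ shift_word (pos q'))"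
    using word_eq_append_right[OF word_eq_sym[OF assms]] by simp
  also have "\<dots> \<approx> shift_word (replicate a (0, True) @ shift_word (pos p'))"
    using w by (rule shift_word_cong)
  finally have 1: "replicate b (Suc 0, True) @ shift_word (shift_word (pos q'))
      \<approx> replicate a (Suc 0, True) @ shift_word (shift_word (pos p'))" by (simp del: pos_simps)
  \<comment> \<open>The exponents are compared with \<open>k = 1\<close>, as both tails have been
    shifted twice.\<close>
  have "b = a"
    using 1 by (intro power_prefix_unique[where u = "[]"]) (auto dest!: fst_shift_word_shift_word simp del: pos_simps)
  with 1 have "shift_word (shift_word (pos p')) \<approx> shift_word (shift_word (pos q'))"
    by (blast intro: word_eq_append_left_cancel word_eq_sym)
  \<comment> \<open>Undoing one of the two shifts is enough: \<open>p'\<close> and \<open>q'\<close>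
    enter the fraction of \<open>w\<close> under one shift.\<close>
  then have "shift_word (pos p') \<approx> shift_word (pos q')"
    by (rule shift_word_shift_word_cancel)
  then have "replicate a (0, True) @ shift_word (pos p') \<approx> [] @ replicate b (0, True) @ shift_word (pos q')"
    unfolding \<open>b = a\<close> by (simp add: word_eq_append_left del: pos_simps)
  with w show ?thesis
    by (blast intro: word_eq_append_right_cancel word_eq_trans)
qed

lemma shift_word_inj:
  assumes "shift_word u \<approx> shift_word v"
  shows "u \<approx> v"
proof -
  have "shift_word (u @ inverse_word v) \<approx> shift_word v @ inverse_word (shift_word v)"
    using word_eq_append_right[OF assms] by (simp add: inverse_shift_word)
  also have "\<dots> \<approx> []" by (rule inverse_word_right)
  finally have "u @ inverse_word v \<approx> []" by (rule shift_word_trivial)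
  also have "[] \<approx> v @ inverse_word v" by (rule word_eq_sym[OF inverse_word_right])
  finally show ?thesis by (rule word_eq_append_right_cancel)
qed

text \<open>Both sides of the fraction start with the same power of \<open>x_0\<close>; removing it
  and one shift gives an equation of the same kind with sizes not increased.\<close>

lemma fraction_unshift:
  assumes "(shift_word ^^ m) w @ pos q \<approx> pos p" "fits N p" "fits N q"
  shows "\<exists>p q. w @ pos q \<approx> pos p \<and> fits N p \<and> fits N q"
  using assms
proof (induction "m + length p" arbitrary: m p q rule: less_induct)
  case less
  show ?case
  proof (cases m)
    case 0
    then show ?thesis using less.prems by auto
  next
    case (Suc k)
    let ?w = "(shift_word ^^ k) w"
    obtain a p' where p': "pos p \<approx> replicate a (0, True) @ shift_word (pos p')"
      "a + length p' = length p" "fits (N - 1) p'"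
      using pos_split_x0[OF less.prems(2)] by blast
    obtain b q' where q': "pos q \<approx> replicate b (0, True) @ shift_word (pos q')" "fits (N - 1) q'"
      using pos_split_x0[OF less.prems(3)] by blast
    have "shift_word ?w @ replicate b (0, True) @ shift_word (pos q') \<approx> (shift_word ^^ m) w @ pos q"
      by (simp add: Suc word_eq_append_left word_eq_sym[OF q'(1)] del: pos_simps)
    also note less.prems(1)
    also note p'(1)
    finally have 1: "shift_word ?w @ replicate b (0, True) @ shift_word (pos q')
        \<approx> replicate a (0, True) @ shift_word (pos p')" .
    then have "b = a"
      by (rule power_prefix_unique) (auto dest!: fst_shift_word_pos simp del: pos_simps)
    \<comment> \<open>Moving the power \<open>x_0^a\<close> in front of \<open>shift_word ?w\<close>
      shifts that word \<open>a\<close> more times. Cancelling the power leaves two shifted words,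
      to which injectivity applies.\<close>
    have "replicate a (0, True) @ shift_word ((shift_word ^^ a) ?w) @ shift_word (pos q')
        \<approx> shift_word ?w @ replicate b (0, True) @ shift_word (pos q')"
      using word_eq_append_right[OF word_eq_sym[OF shift_word_x0_power[of ?w a]], of "shift_word (pos q')"]
      by (simp add: \<open>b = a\<close> del: pos_simps)
    also note 1
    finally have "shift_word ((shift_word ^^ (a + k)) w @ pos q') \<approx> shift_word (pos p')"
      by (auto dest: word_eq_append_left_cancel simp: funpow_add simp del: pos_simps)
    then have "(shift_word ^^ (a + k)) w @ pos q' \<approx> pos p'" by (rule shift_word_inj)
    \<comment> \<open>The number of shifts goes from \<open>k + 1\<close> to \<open>a + k\<close>,
      the length of the numerator from \<open>length p\<close> to \<open>length p - a\<close>, so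
      the measure drops by exactly 1.\<close>
    then show ?thesis
      using less.hyps[of "a + k" p' q'] p'(2) Suc fits_mono[OF p'(3), of N] fits_mono[OF q'(2), of N]
      by simp
  qed
qed

section \<open>Word length\<close>

text \<open>A bound instead of an exact length makes the notion monotone in \<open>n\<close> and
  subadditive under concatenation, without \<open>LEAST\<close>.\<close>

definition length_at_most :: "nat word \<Rightarrow> nat \<Rightarrow> bool" where
  "length_at_most w n \<longleftrightarrow> (\<exists>v. v \<approx> w \<and> length v \<le> n \<and> fst ` set v \<subseteq> {0, 1})"

lemma length_at_most_cong: "length_at_most u n \<Longrightarrow> u \<approx> v \<Longrightarrow> length_at_most v n"
  unfolding length_at_most_def by (blast intro: word_eq_trans)

lemma length_at_most_mono: "length_at_most u n \<Longrightarrow> n \<le> m \<Longrightarrow> length_at_most u m"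
  unfolding length_at_most_def by (blast intro: le_trans)

lemma length_at_most_append:
  "length_at_most u n \<Longrightarrow> length_at_most v m \<Longrightarrow> length_at_most (u @ v) (n + m)"
  unfolding length_at_most_def
proof (elim exE conjE)
  fix u' v'
  assume "u' \<approx> u" "length u' \<le> n" "fst ` set u' \<subseteq> {0, 1}"
    and "v' \<approx> v" "length v' \<le> m" "fst ` set v' \<subseteq> {0, 1}"
  then show "\<exists>t. t \<approx> u @ v \<and> length t \<le> n + m \<and> fst ` set t \<subseteq> {0, 1}"
    by (intro exI[of _ "u' @ v'"] conjI word_eq_append) (simp_all add: image_Un)
qed

lemma length_at_most_self: "fst ` set v \<subseteq> {0, 1} \<Longrightarrow> length_at_most v (length v)"
  unfolding length_at_most_def by (blast intro: word_eq_refl)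

lemma length_at_most_power: "k \<le> 1 \<Longrightarrow> length_at_most (replicate a (k, b)) a"
  using length_at_most_self[of "replicate a (k, b)"] by (fastforce simp: image_subset_iff)

lemma length_at_most_inverse: "length_at_most w n \<Longrightarrow> length_at_most (inverse_word w) n"
proof -
  assume "length_at_most w n"
  then obtain v where v: "v \<approx> w" "length v \<le> n" "fst ` set v \<subseteq> {0, 1}"
    by (auto simp: length_at_most_def)
  have "inverse_word v @ w \<approx> inverse_word v @ v" by (intro word_eq_append_left word_eq_sym[OF v(1)])
  also have "\<dots> \<approx> []" by (rule inverse_word_left)
  also have "\<dots> \<approx> inverse_word w @ w" by (rule word_eq_sym[OF inverse_word_left])
  finally have "inverse_word v \<approx> inverse_word w" by (rule word_eq_append_right_cancel)
  moreover have "length (inverse_word v) \<le> n" "fst ` set (inverse_word v) \<subseteq> {0, 1}"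
    using v by (auto simp: inverse_word_def)
  ultimately show ?thesis unfolding length_at_most_def by blast
qed

lemma shift_word_conj: "shift_word (shift_word w) \<approx> [(0, False)] @ shift_word w @ [(0, True)]"
proof -
  have "shift_word (shift_word w) \<approx> [(0, False), (0, True)] @ shift_word (shift_word w)"
    using word_eq_cancel[of thompson_relations "[]" 0 False] by (simp add: word_eq_sym)
  also have "\<dots> \<approx> [(0, False)] @ shift_word w @ [(0, True)]"
    using word_eq_append_left[OF word_eq_sym[OF shift_word_x0[of w]], of "[(0, False)]"] by simp
  finally show ?thesis .
qed

text \<open>After the shift the leading power of \<open>x_0\<close> is a power of
  \<open>x_1\<close>, and the doubly shifted remainder is a conjugate by \<open>x_0\<close> of the
  singly shifted one. Each level costs two letters \<open>x_0\<close> or its inverse; the powers of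
  \<open>x_1\<close> total at most \<open>length p\<close>.\<close>

lemma length_at_most_shift_pos: "fits N p \<Longrightarrow> length_at_most (shift_word (pos p)) (length p + 2 * N)"
proof (induction N arbitrary: p)
  case 0
  then show ?case using fits_length[OF 0] length_at_most_self[of "[]"] by simp
next
  case (Suc N)
  obtain a p' where p': "pos p \<approx> replicate a (0, True) @ shift_word (pos p')"
    "a + length p' = length p" "fits N p'"
    using pos_split_x0[OF Suc.prems] by auto
  have "replicate a (1, True) @ [(0, False)] @ shift_word (pos p') @ [(0, True)]
      \<approx> replicate a (1, True) @ shift_word (shift_word (pos p'))"
    by (intro word_eq_append_left word_eq_sym[OF shift_word_conj])
  also have "\<dots> \<approx> shift_word (pos p)"
    using shift_word_cong[OF word_eq_sym[OF p'(1)]] by (simp del: pos_simps)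
  finally have *: "replicate a (1, True) @ [(0, False)] @ shift_word (pos p') @ [(0, True)] \<approx> shift_word (pos p)" .
  have letter: "length_at_most [(0, b)] 1" for b
    using length_at_most_self[of "[(0, b)]"] by simp
  have "length_at_most (replicate a (1, True) @ [(0, False)] @ shift_word (pos p') @ [(0, True)])
      (a + (1 + ((length p' + 2 * N) + 1)))"
    by (intro length_at_most_append length_at_most_power Suc.IH p'(3) letter) simp
  from length_at_most_mono[OF length_at_most_cong[OF this *]]
  show ?case using p'(2) by simp
qed

lemma length_at_most_pos:
  assumes "fits N p"
  shows "length_at_most (pos p) (3 * N)"
proof -
  obtain a p' where p': "pos p \<approx> replicate a (0, True) @ shift_word (pos p')"
    "a + length p' = length p" "fits (N - 1) p'"
    using pos_split_x0[OF assms] by auto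
  have "length_at_most (replicate a (0, True) @ shift_word (pos p')) (a + (length p' + 2 * (N - 1)))"
    by (intro length_at_most_append length_at_most_power length_at_most_shift_pos p'(3)) simp
  from length_at_most_mono[OF length_at_most_cong[OF this word_eq_sym[OF p'(1)]]]
  show ?thesis using p'(2) fits_length[OF assms] by simp
qed

text \<open>The constant is \<open>12 = 2 * 3 * 2\<close>: each letter contributes at most 2 to the
  size, a positive word is at most 3 times as long as its size, and a fraction has two parts. It is
  independent of \<open>m\<close>.\<close>

lemma length_at_most_unshift:
  assumes "length_at_most ((shift_word ^^ m) w) n"
  shows "length_at_most w (12 * n)"
proof -
  obtain v where v: "v \<approx> (shift_word ^^ m) w" "length v \<le> n" "fst ` set v \<subseteq> {0, 1}"
    using assms by (auto simp: length_at_most_def)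
  have "(\<Sum>(i, b)\<leftarrow>v. i + 1) \<le> 2 * length v"
    using v(3)
  proof (induction v)
    case (Cons l v)
    then show ?case by (cases l) auto
  qed simp
  then have N: "(\<Sum>(i, b)\<leftarrow>v. i + 1) \<le> 2 * n" using v(2) by linarith
  obtain p q where pq: "v @ pos q \<approx> pos p"
    and fits: "fits (\<Sum>(i, b)\<leftarrow>v. i + 1) p" "fits (\<Sum>(i, b)\<leftarrow>v. i + 1) q"
    using fraction_exists[of v] by (elim exE conjE)
  have "(shift_word ^^ m) w @ pos q \<approx> v @ pos q"
    by (rule word_eq_append_right[OF word_eq_sym[OF v(1)]])
  also note pq
  finally have "(shift_word ^^ m) w @ pos q \<approx> pos p" .
  from fraction_unshift[OF this fits_mono[OF fits(1) N] fits_mono[OF fits(2) N]]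
  obtain p' q' where pq': "w @ pos q' \<approx> pos p'" "fits (2 * n) p'" "fits (2 * n) q'"
    by blast
  have "pos p' @ inverse_word (pos q') \<approx> w @ pos q' @ inverse_word (pos q')"
    using word_eq_append_right[OF word_eq_sym[OF pq'(1)]] by simp
  also have "\<dots> \<approx> w"
    using word_eq_append_left[OF inverse_word_right[of thompson_relations "pos q'"], of w] by simp
  finally have *: "pos p' @ inverse_word (pos q') \<approx> w" .
  have "length_at_most (pos p' @ inverse_word (pos q')) (3 * (2 * n) + 3 * (2 * n))"
    by (intro length_at_most_append length_at_most_inverse length_at_most_pos pq')
  from length_at_most_cong[OF this *] show ?thesis by simp
qed

lemma length_at_most_shift:
  assumes "length_at_most w n"
  shows "length_at_most (shift_word w) (3 * n)"
proof -
  obtain v where v: "v \<approx> w" "length v \<le> n" "fst ` set v \<subseteq> {0, 1}"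
    using assms by (auto simp: length_at_most_def)
  have letter: "length_at_most (shift_word [(k, b)]) 3" if "k \<in> {0, 1}" for k b
  proof (cases "k = 0")
    case True
    then show ?thesis
      using length_at_most_self[of "[(1, b)]"] by (auto intro: length_at_most_mono)
  next
    case False
    have "[(0, False), (Suc 0, b), (0, True)] \<approx> [(2, b)]"
      using word_eq_sym[OF shift_word_conj[of "[(0, b)]"]] by (simp add: numeral_2_eq_2)
    then show ?thesis
      using False that length_at_most_self[of "[(0, False), (Suc 0, b), (0, True)]"]
      by (auto intro: length_at_most_cong simp: numeral_2_eq_2 numeral_3_eq_3)
  qed
  have "length_at_most (shift_word v) (3 * length v)"
    using v(3)
  proof (induction v)
    case Nil
    show ?case using length_at_most_self[of "[]"] by simp
  next
    case (Cons l v)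
    obtain k b where l: "l = (k, b)" by force
    have "length_at_most (shift_word [(k, b)] @ shift_word v) (3 + 3 * length v)"
      using Cons by (intro length_at_most_append letter) (auto simp: l)
    then show ?case by (simp add: l)
  qed
  then show ?thesis
    using v(2) by (elim length_at_most_mono[OF length_at_most_cong[OF _ shift_word_cong[OF v(1)]]]) simp
qed

lemma length_at_most_funpow_shift:
  "length_at_most w n \<Longrightarrow> length_at_most ((shift_word ^^ m) w) (3 ^ m * n)"
proof (induction m)
  case (Suc m)
  then show ?case using length_at_most_shift[of "(shift_word ^^ m) w" "3 ^ m * n"] by (simp add: mult.assoc)
qed simp

section \<open>From words to the word metric of \<open>F\<close>\<close>

lemma foldr_mult_presented_group:
  "foldr (mult (presented_group R)) (map (\<lambda>l. word_class R [l]) v) \<one>\<^bsub>presented_group R\<^esub> = word_class R v"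
  by (induction v) (simp_all add: one_presented_group mult_presented_group)

lemma generators_and_inverses:
  "{thompson_x 0, thompson_x 1} \<union> m_inv thompson_F ` {thompson_x 0, thompson_x 1}
   = (\<lambda>l. word_class thompson_relations [l]) ` {l. fst l \<in> {0, 1}}"
proof -
  have "{l :: nat \<times> bool. fst l \<in> {0, 1}} = {(0, True), (1, True), (0, False), (1, False)}"
    by auto
  then show ?thesis
    by (simp only:) (simp add: thompson_x_def thompson_F_def inv_letter_presented_group, blast)
qed

text \<open>\<open>length_at_most w\<close> is the upward closure of the set of exact lengths, so
  both have the same least element.\<close>

lemma word_length_thompson_F:
  "word_length thompson_F {thompson_x 0, thompson_x 1} (word_class thompson_relations w)
   = (LEAST n. length_at_most w n)"
proof -
  let ?c = "\<lambda>l. word_class thompson_relations [l]"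
  define P where "P n \<longleftrightarrow> (\<exists>ws. set ws \<subseteq> ?c ` {l. fst l \<in> {0, 1}} \<and> length ws = n \<and>
      foldr (mult thompson_F) ws \<one>\<^bsub>thompson_F\<^esub> = word_class thompson_relations w)" for n
  have P: "P n \<longleftrightarrow> (\<exists>v. v \<approx> w \<and> length v = n \<and> fst ` set v \<subseteq> {0, 1})" (is "_ \<longleftrightarrow> ?Q n") for n
  proof
    assume "P n"
    then obtain ws where ws: "set ws \<subseteq> ?c ` {l. fst l \<in> {0, 1}}" "length ws = n"
      "foldr (mult thompson_F) ws \<one>\<^bsub>thompson_F\<^esub> = word_class thompson_relations w"
      unfolding P_def by blast
    have "ws \<in> lists (?c ` {l. fst l \<in> {0, 1}})" using ws(1) by auto
    then obtain v where "v \<in> lists {l. fst l \<in> {0, 1}}" "ws = map ?c v"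
      unfolding lists_image by blast
    with ws show "?Q n"
      by (intro exI[of _ v])
         (auto simp: thompson_F_def foldr_mult_presented_group word_class_eq_iff)
  next
    assume "?Q n"
    then obtain v where "v \<approx> w" "length v = n" "fst ` set v \<subseteq> {0, 1}" by blast
    then show "P n"
      unfolding P_def thompson_F_def
      by (intro exI[of _ "map ?c v"]) (auto simp: foldr_mult_presented_group word_class_eq_iff)
  qed
  have L: "length_at_most w n \<longleftrightarrow> (\<exists>m\<le>n. P m)" for n
    unfolding P length_at_most_def by blast
  have "(LEAST n. P n) = (LEAST n. length_at_most w n)"
  proof (cases "\<exists>n. P n")
    case True
    then obtain n where "P n" ..
    show ?thesis
    proof (rule Least_equality[symmetric])
      show "length_at_most w (LEAST n. P n)"
        unfolding L using LeastI[of P, OF \<open>P n\<close>] by blast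
    next
      fix m assume "length_at_most w m"
      then show "(LEAST n. P n) \<le> m"
        unfolding L by (blast intro: Least_le order_trans)
    qed
  next
    case False
    \<comment> \<open>Both predicates are then everywhere false, so \<open>LEAST\<close> denotes the
      same value for both.\<close>
    then have "P = length_at_most w" by (simp add: fun_eq_iff L)
    then show ?thesis by simp
  qed
  then show ?thesis
    unfolding word_length_def generators_and_inverses P_def .
qed

text \<open>The least bound is attained once some bound exists, and the fraction of \<open>w\<close>
  supplies one.\<close>

lemma length_at_most_word_length:
  "length_at_most w (word_length thompson_F {thompson_x 0, thompson_x 1} (word_class thompson_relations w))"
proof -
  obtain p q N where pq: "w @ pos q \<approx> pos p" "fits N p" "fits N q"
    using fraction_exists by blast
  have "length_at_most ((w @ pos q) @ inverse_word (pos q)) (3 * N + 3 * N)"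
    using pq by (intro length_at_most_append length_at_most_inverse length_at_most_pos)
      (rule length_at_most_cong[OF length_at_most_pos word_eq_sym])
  moreover have "(w @ pos q) @ inverse_word (pos q) \<approx> w"
    using word_eq_append_left[OF inverse_word_right[of thompson_relations "pos q"], of w] by simp
  ultimately have "length_at_most w (3 * N + 3 * N)" by (rule length_at_most_cong)
  then show ?thesis unfolding word_length_thompson_F by (rule LeastI)
qed

lemma word_length_le:
  "length_at_most w n \<Longrightarrow>
   word_length thompson_F {thompson_x 0, thompson_x 1} (word_class thompson_relations w) \<le> n"
  unfolding word_length_thompson_F by (rule Least_le)

lemma funpow_shift_word_class:
  "(shift ^^ n) (word_class thompson_relations w) = word_class thompson_relations ((shift_word ^^ n) w)"
  by (induction n) (simp_all add: shift_word_class shift_word_def)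

theorem theorem3p1:
  fixes n :: nat
  shows "quasi_isometric_embedding
           (carrier thompson_F) (word_metric thompson_F {thompson_x 0, thompson_x 1})
           (carrier thompson_F) (word_metric thompson_F {thompson_x 0, thompson_x 1})
           (shift ^^ n)"
proof -
  let ?S = "{thompson_x 0, thompson_x 1}"
  let ?c = "word_class thompson_relations"
  \<comment> \<open>One constant for both sides: 12 for the lower bound, \<open>3 ^ n\<close> for
    the upper. The additive constant is 0.\<close>
  define K :: real where "K = 12 * 3 ^ n"
  have pow: "1 \<le> (3 :: real) ^ n" by simp
  have bounds: "1 / K * word_metric thompson_F ?S u v - 0
          \<le> word_metric thompson_F ?S ((shift ^^ n) u) ((shift ^^ n) v) \<and>
        word_metric thompson_F ?S ((shift ^^ n) u) ((shift ^^ n) v)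
          \<le> K * word_metric thompson_F ?S u v + 0"
    if uv: "u \<in> carrier thompson_F" "v \<in> carrier thompson_F" for u v
  proof -
    obtain a b where ab: "u = ?c a" "v = ?c b"
      using uv by (auto simp: thompson_F_def carrier_presented_group)
    \<comment> \<open>The iterated shift is a homomorphism, so both distances are lengths: of
      \<open>w\<close> and of its \<open>n\<close>-fold shift.\<close>
    define w where "w = inverse_word a @ b"
    let ?l = "word_length thompson_F ?S (?c w)"
    let ?l' = "word_length thompson_F ?S (?c ((shift_word ^^ n) w))"
    have d: "word_metric thompson_F ?S u v = ?l"
      by (simp add: ab w_def word_metric_def thompson_F_def inv_presented_group mult_presented_group)
    have d': "word_metric thompson_F ?S ((shift ^^ n) u) ((shift ^^ n) v) = ?l'"
      by (simp add: ab w_def word_metric_def thompson_F_def inv_presented_group mult_presented_group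
          funpow_shift_word_class funpow_shift_word_append inverse_funpow_shift_word)
    have "?l \<le> 12 * ?l'"
      by (intro word_length_le length_at_most_unshift[of n] length_at_most_word_length)
    then have "real ?l \<le> 12 * real ?l'" by linarith
    also have "\<dots> \<le> K * real ?l'"
      using pow by (intro mult_right_mono) (auto simp: K_def)
    finally have lower: "real ?l \<le> K * real ?l'" .
    have "?l' \<le> 3 ^ n * ?l"
      by (intro word_length_le length_at_most_funpow_shift length_at_most_word_length)
    then have "real ?l' \<le> real (3 ^ n * ?l)" by (rule of_nat_mono)
    also have "\<dots> \<le> K * real ?l" by (simp add: K_def)
    finally have upper: "real ?l' \<le> K * real ?l" .
    have "0 < K" by (simp add: K_def)
    with lower upper show ?thesis unfolding d d' by (simp add: field_simps)
  qed
  have "K \<ge> 1" using pow unfolding K_def by linarith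
  moreover have "shift ^^ n \<in> carrier thompson_F \<rightarrow> carrier thompson_F"
    by (auto simp: thompson_F_def carrier_presented_group funpow_shift_word_class)
  ultimately show ?thesis
    unfolding quasi_isometric_embedding_def using bounds by (blast intro: order_refl)
qed

end
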